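(* For all $j,k\in\mathbb Z$, the two-dimensional CU scheme described in the context admits the decomposition $$ \begin{aligned} \overline{\mathbf u}^{\,n+1}_{j,k}={}&\Big(\tfrac{\lambda^n\alpha_1}{2(\lambda^n\alpha_1+\mu^n\alpha_2)}-\lambda^n\big(\sigma^+_{j-\frac12,k}-\sigma^-_{j-\frac12,k}\big)\Big)\mathbf u^+_{j-\frac12,k}+\lambda^n\sigma^+_{j-\frac12,k}\mathbf u^{*,-}_{j-\frac12,k}\\ &+\Big(\tfrac{\lambda^n\alpha_1}{2(\lambda^n\alpha_1+\mu^n\alpha_2)}-\lambda^n\big(\sigma^+_{j+\frac12,k}-\sigma^-_{j+\frac12,k}\big)\Big)\mathbf u^-_{j+\frac12,k}-\lambda^n\sigma^-_{j+\frac12,k}\mathbf u^{*,+}_{j+\frac12,k}+\lambda^n\big(\sigma^+_{j+\frac12,k}-\sigma^-_{j-\frac12,k}\big)\mathbf u^{*,x}_{j,k}\\ &+\Big(\tfrac{\mu^n\alpha_2}{2(\lambda^n\alpha_1+\mu^n\alpha_2)}-\mu^n\big(\sigma^+_{j,k-\frac12}-\sigma^-_{j,k-\frac12}\big)\Big)\mathbf u^+_{j,k-\frac12}+\mu^n\sigma^+_{j,k-\frac12}\mathbf u^{*,-}_{j,k-\frac12}\\ &+\Big(\tfrac{\mu^n\alpha_2}{2(\lambda^n\alpha_1+\mu^n\alpha_2)}-\mu^n\big(\sigma^+_{j,k+\frac12}-\sigma^-_{j,k+\frac12}\big)\Big)\mathbf u^-_{j,k+\frac12}-\mu^n\sigma^-_{j,k+\frac12}\mathbf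 u^{*,+}_{j,k+\frac12}+\mu^n\big(\sigma^+_{j,k+\frac12}-\sigma^-_{j,k-\frac12}\big)\mathbf u^{*,y}_{j,k}, \end{aligned} $$ where $$\alpha_1:=\max_{j,k}\big\{\sigma^+_{j+\frac12,k}-\sigma^-_{j+\frac12,k}\big\},\qquad \alpha_2:=\max_{j,k}\big\{\sigma^+_{j,k+\frac12}-\sigma^-_{j,k+\frac12}\big\},$$ and this is a convex combination (all coefficients are nonnegative and sum to $1$) under the CFL condition $$\lambda^n\alpha_1+\mu^n\alpha_2\le\tfrac12.$$
   Context: Consider a 2-D hyperbolic system $\mathbf u_t+\mathbf f(\mathbf u)_x+\mathbf g(\mathbf u)_y=\mathbf 0$, $\mathbf u\in\mathbb R^m$. Let $A=\partial\mathbf f/\partial\mathbf u$, $B=\partial\mathbf g/\partial\mathbf u$, and let $\lambda_1(\cdot),\lambda_m(\cdot)$ denote the smallest and largest eigenvalues. Given $\Delta x,\Delta y,\Delta t^n>0$, $\lambda^n:=\Delta t^n/\Delta x$, $\mu^n:=\Delta t^n/\Delta y$, and cell averages $\overline{\mathbf u}_{j,k}^{\,n}$, $j,k\in\mathbb Z$ (all point values below are assumed to lie in the domain where the fluxes and eigenvalues are defined), the 2-D CU scheme is $$\overline{\mathbf u}^{\,n+1}_{j,k}=\overline{\mathbf u}^{\,n}_{j,k}-\lambda^n\big(\hat{\mathbf f}_{j+\frac12,k}-\hat{\mathbf f}_{j-\frac12,k}\big)-\mu^n\big(\hat{\mathbf g}_{j,k+\frac12}-\hat{\mathbf g}_{j,k-\frac12}\big),$$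 $$\hat{\mathbf f}_{j+\frac12,k}=\tfrac{\sigma^+_{j+\frac12,k}\mathbf f(\mathbf u^-_{j+\frac12,k})-\sigma^-_{j+\frac12,k}\mathbf f(\mathbf u^+_{j+\frac12,k})}{\sigma^+_{j+\frac12,k}-\sigma^-_{j+\frac12,k}}+\tfrac{\sigma^+_{j+\frac12,k}\sigma^-_{j+\frac12,k}}{\sigma^+_{j+\frac12,k}-\sigma^-_{j+\frac12,k}}\big(\mathbf u^+_{j+\frac12,k}-\mathbf u^-_{j+\frac12,k}-\mathbf d_{j+\frac12,k}\big),$$ $$\hat{\mathbf g}_{j,k+\frac12}=\tfrac{\sigma^+_{j,k+\frac12}\mathbf g(\mathbf u^-_{j,k+\frac12})-\sigma^-_{j,k+\frac12}\mathbf g(\mathbf u^+_{j,k+\frac12})}{\sigma^+_{j,k+\frac12}-\sigma^-_{j,k+\frac12}}+\tfrac{\sigma^+_{j,k+\frac12}\sigma^-_{j,k+\frac12}}{\sigma^+_{j,k+\frac12}-\sigma^-_{j,k+\frac12}}\big(\mathbf u^+_{j,k+\frac12}-\mathbf u^-_{j,k+\frac12}-\mathbf d_{j,k+\frac12}\big).$$ Reconstruction: $\mathbf u^-_{j+\frac12,k}=\overline{\mathbf u}_{j,k}^{\,n}+\frac{\Delta x}2(\mathbf u_x)_{j,k}^n$, $\mathbf u^+_{j+\frac12,k}=\overline{\mathbf u}_{j+1,k}^{\,n}-\frac{\Delta x}2(\mathbf u_x)_{j+1,k}^n$, $\mathbf u^-_{j,k+\frac12}=\overline{\mathbf u}_{j,k}^{\,n}+\frac{\Delta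 y}2(\mathbf u_y)_{j,k}^n$, $\mathbf u^+_{j,k+\frac12}=\overline{\mathbf u}_{j,k+1}^{\,n}-\frac{\Delta y}2(\mathbf u_y)_{j,k+1}^n$, with, for $\theta\in[1,2]$, $$(\mathbf u_x)_{j,k}^n=\mathrm{minmod}\Big(\theta\tfrac{\overline{\mathbf u}_{j,k}^{\,n}-\overline{\mathbf u}_{j-1,k}^{\,n}}{\Delta x},\tfrac{\overline{\mathbf u}_{j+1,k}^{\,n}-\overline{\mathbf u}_{j-1,k}^{\,n}}{2\Delta x},\theta\tfrac{\overline{\mathbf u}_{j+1,k}^{\,n}-\overline{\mathbf u}_{j,k}^{\,n}}{\Delta x}\Big),$$ $$(\mathbf u_y)_{j,k}^n=\mathrm{minmod}\Big(\theta\tfrac{\overline{\mathbf u}_{j,k}^{\,n}-\overline{\mathbf u}_{j,k-1}^{\,n}}{\Delta y},\tfrac{\overline{\mathbf u}_{j,k+1}^{\,n}-\overline{\mathbf u}_{j,k-1}^{\,n}}{2\Delta y},\theta\tfrac{\overline{\mathbf u}_{j,k+1}^{\,n}-\overline{\mathbf u}_{j,k}^{\,n}}{\Delta y}\Big).$$ Here $\mathrm{minmod}(c_1,c_2,\dots)$ equals $\min\{c_i\}$ if all $c_i>0$, $\max\{c_i\}$ if all $c_i<0$, and $0$ otherwise; it is applied componentwise. Speeds: $\sigma^-_{j+\frac12,k}=\min\{\lambda_1(A(\mathbf u^-_{j+\frac12,k})),\lambda_1(A(\mathbf u^+_{j+\frac12,k})),0\}$, $\sigma^+_{j+\frac12,k}=\max\{\lambda_m(A(\mathbf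 u^-_{j+\frac12,k})),\lambda_m(A(\mathbf u^+_{j+\frac12,k})),0\}$, $\sigma^-_{j,k+\frac12}=\min\{\lambda_1(B(\mathbf u^-_{j,k+\frac12})),\lambda_1(B(\mathbf u^+_{j,k+\frac12})),0\}$, $\sigma^+_{j,k+\frac12}=\max\{\lambda_m(B(\mathbf u^-_{j,k+\frac12})),\lambda_m(B(\mathbf u^+_{j,k+\frac12})),0\}$; at any interface where the difference $\sigma^+-\sigma^-$ is smaller than a fixed small $\varepsilon>0$, these are replaced by $\sigma^\pm=\pm\varepsilon$. It is also assumed that $\sigma^+_{j+\frac12,k}>\sigma^-_{j-\frac12,k}$ and $\sigma^+_{j,k+\frac12}>\sigma^-_{j,k-\frac12}$ for all $j,k$, so that $\mathbf u^{*,x}_{j,k},\mathbf u^{*,y}_{j,k}$ below are well defined. Anti-diffusion: $\mathbf d_{j+\frac12,k}=\mathrm{minmod}(\mathbf u^+_{j+\frac12,k}-\mathbf u^*_{j+\frac12,k},\mathbf u^*_{j+\frac12,k}-\mathbf u^-_{j+\frac12,k})$ and $\mathbf d_{j,k+\frac12}=\mathrm{minmod}(\mathbf u^+_{j,k+\frac12}-\mathbf u^*_{j,k+\frac12},\mathbf u^*_{j,k+\frac12}-\mathbf u^-_{j,k+\frac12})$, where $\mathbf u^*_{j+\frac12,k}=R_f(\sigma^+_{j+\frac12,k},\sigma^-_{j+\frac12,k},\mathbf u^+_{j+\frac12,k},\mathbf u^-_{j+\frac12,k})$, $\mathbf u^*_{j,k+\frac12}=R_g(\sigma^+_{j,k+\frac12},\sigma^-_{j,k+\frac12},\mathbf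 u^+_{j,k+\frac12},\mathbf u^-_{j,k+\frac12})$, and for $\mathbf h=\mathbf f$ or $\mathbf g$ (giving $R_h=R_f$ or $R_g$) $$R_h(\sigma^+,\sigma^-,\mathbf u^+,\mathbf u^-):=\frac{\sigma^+\mathbf u^+-\sigma^-\mathbf u^--\mathbf h(\mathbf u^+)+\mathbf h(\mathbf u^-)}{\sigma^+-\sigma^-}.$$ Intermediate states: $$\mathbf u^{*,\pm}_{j+\frac12,k}:=\mathbf u^*_{j+\frac12,k}-\tfrac{\sigma^\pm_{j+\frac12,k}}{\sigma^+_{j+\frac12,k}-\sigma^-_{j+\frac12,k}}\mathbf d_{j+\frac12,k},\quad \mathbf u^{*,x}_{j,k}:=R_f\big(\sigma^+_{j+\frac12,k},\sigma^-_{j-\frac12,k},\mathbf u^-_{j+\frac12,k},\mathbf u^+_{j-\frac12,k}\big),$$ $$\mathbf u^{*,\pm}_{j,k+\frac12}:=\mathbf u^*_{j,k+\frac12}-\tfrac{\sigma^\pm_{j,k+\frac12}}{\sigma^+_{j,k+\frac12}-\sigma^-_{j,k+\frac12}}\mathbf d_{j,k+\frac12},\quad \mathbf u^{*,y}_{j,k}:=R_g\big(\sigma^+_{j,k+\frac12},\sigma^-_{j,k-\frac12},\mathbf u^-_{j,k+\frac12},\mathbf u^+_{j,k-\frac12}\big).$$ *)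

theory Defs
  imports "HOL-Analysis.Analysis"
begin

definition eigenvalues :: "real ^ 'm ^ 'm \<Rightarrow> real set" where
  "eigenvalues M = {l. \<exists>v. v \<noteq> 0 \<and> M *v v = l *\<^sub>R v}"

definition min_eigenvalue :: "real ^ 'm ^ 'm \<Rightarrow> real" where
  "min_eigenvalue M = Min (eigenvalues M)"

definition max_eigenvalue :: "real ^ 'm ^ 'm \<Rightarrow> real" where
  "max_eigenvalue M = Max (eigenvalues M)"

definition real_diagonalizable :: "real ^ 'm ^ 'm \<Rightarrow> bool" where
  "real_diagonalizable M \<longleftrightarrow> span {v. \<exists>l. M *v v = l *\<^sub>R v} = UNIV"

abbreviation Jac :: "(real ^ 'm \<Rightarrow> real ^ 'm) \<Rightarrow> real ^ 'm \<Rightarrow> real ^ 'm ^ 'm" where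
  "Jac h u \<equiv> jacobian h (at u)"

text \<open>Fluxes are total functions here; \<open>D\<close> is the domain on which they are meaningful.\<close>

definition hyperbolic_on ::
  "(real ^ 'm) set \<Rightarrow> (real ^ 'm \<Rightarrow> real ^ 'm) \<Rightarrow> (real ^ 'm \<Rightarrow> real ^ 'm) \<Rightarrow> bool" where
  "hyperbolic_on D f g \<longleftrightarrow>
     (\<forall>u\<in>D. f differentiable (at u) \<and> g differentiable (at u) \<and>
        (\<forall>a b :: real. real_diagonalizable (a *\<^sub>R Jac f u + b *\<^sub>R Jac g u)))"

definition minmod :: "real list \<Rightarrow> real" where
  "minmod cs = (if \<forall>c\<in>set cs. c > 0 then Min (set cs)
                else if \<forall>c\<in>set cs. c < 0 then Max (set cs) else 0)"

definition vminmod :: "(real ^ 'm) list \<Rightarrow> real ^ 'm" where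
  "vminmod vs = (\<chi> i. minmod (map (\<lambda>v. v $ i) vs))"

definition limited_slope ::
  "real \<Rightarrow> real \<Rightarrow> real ^ 'm \<Rightarrow> real ^ 'm \<Rightarrow> real ^ 'm \<Rightarrow> real ^ 'm" where
  "limited_slope \<theta> h ul uc ur =
     vminmod [(\<theta> / h) *\<^sub>R (uc - ul), (1 / (2 * h)) *\<^sub>R (ur - ul), (\<theta> / h) *\<^sub>R (ur - uc)]"

text \<open>Below, \<open>up\<close> and \<open>um\<close> are the traces from the right/upper and from the left/lower
  side of an interface.\<close>

definition raw_speed_plus ::
  "(real ^ 'm \<Rightarrow> real ^ 'm) \<Rightarrow> real ^ 'm \<Rightarrow> real ^ 'm \<Rightarrow> real" where
  "raw_speed_plus h up um =
     Max {max_eigenvalue (Jac h um), max_eigenvalue (Jac h up), 0}"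

definition raw_speed_minus ::
  "(real ^ 'm \<Rightarrow> real ^ 'm) \<Rightarrow> real ^ 'm \<Rightarrow> real ^ 'm \<Rightarrow> real" where
  "raw_speed_minus h up um =
     Min {min_eigenvalue (Jac h um), min_eigenvalue (Jac h up), 0}"

definition speed_plus ::
  "real \<Rightarrow> (real ^ 'm \<Rightarrow> real ^ 'm) \<Rightarrow> real ^ 'm \<Rightarrow> real ^ 'm \<Rightarrow> real" where
  "speed_plus \<epsilon> h up um =
     (if raw_speed_plus h up um - raw_speed_minus h up um < \<epsilon> then \<epsilon>
      else raw_speed_plus h up um)"

definition speed_minus ::
  "real \<Rightarrow> (real ^ 'm \<Rightarrow> real ^ 'm) \<Rightarrow> real ^ 'm \<Rightarrow> real ^ 'm \<Rightarrow> real" where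
  "speed_minus \<epsilon> h up um =
     (if raw_speed_plus h up um - raw_speed_minus h up um < \<epsilon> then - \<epsilon>
      else raw_speed_minus h up um)"

definition riemann_avg ::
  "(real ^ 'm \<Rightarrow> real ^ 'm) \<Rightarrow> real \<Rightarrow> real \<Rightarrow> real ^ 'm \<Rightarrow> real ^ 'm \<Rightarrow> real ^ 'm" where
  "riemann_avg h sp sm up um =
     (1 / (sp - sm)) *\<^sub>R (sp *\<^sub>R up - sm *\<^sub>R um - h up + h um)"

definition anti_diffusion :: "real ^ 'm \<Rightarrow> real ^ 'm \<Rightarrow> real ^ 'm \<Rightarrow> real ^ 'm" where
  "anti_diffusion us up um = vminmod [up - us, us - um]"

definition cu_flux ::
  "(real ^ 'm \<Rightarrow> real ^ 'm) \<Rightarrow> real \<Rightarrow> real \<Rightarrow> real ^ 'm \<Rightarrow> real ^ 'm \<Rightarrow> real ^ 'm \<Rightarrow> real ^ 'm" where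
  "cu_flux h sp sm up um d =
     (1 / (sp - sm)) *\<^sub>R (sp *\<^sub>R h um - sm *\<^sub>R h up)
     + (sp * sm / (sp - sm)) *\<^sub>R (up - um - d)"

text \<open>The field \<open>ubar\<close> holds the cell averages at the current time level.\<close>

record ('m::finite) cu_data =
  dom  :: "(real ^ 'm) set"
  fl_f :: "real ^ 'm \<Rightarrow> real ^ 'm"
  fl_g :: "real ^ 'm \<Rightarrow> real ^ 'm"
  dx   :: real
  dy   :: real
  dt   :: real
  theta :: real
  eps  :: real
  ubar :: "int \<Rightarrow> int \<Rightarrow> real ^ 'm"

text \<open>Indexing convention: a quantity with suffix \<open>x\<close> (in \<open>ux_plus\<close>, \<open>sx_plus\<close>, \<open>fhat\<close>, ...)
  at \<open>j k\<close> lives on the interface \<open>(j+1/2, k)\<close>, and its \<open>y\<close>-counterpart on \<open>(j, k+1/2)\<close>;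
  thus \<open>(j-1/2, k)\<close> is addressed by \<open>j-1, k\<close>.  The exceptions are \<open>slope_x\<close>, \<open>slope_y\<close>,
  \<open>ustar_cell_x\<close>, \<open>ustar_cell_y\<close>, which belong to the cell \<open>(j, k)\<close>.\<close>

definition lam :: "('m::finite) cu_data \<Rightarrow> real" where "lam S = dt S / dx S"

definition mu :: "('m::finite) cu_data \<Rightarrow> real" where "mu S = dt S / dy S"

definition slope_x :: "('m::finite) cu_data \<Rightarrow> int \<Rightarrow> int \<Rightarrow> real ^ 'm" where
  "slope_x S j k =
     limited_slope (theta S) (dx S) (ubar S (j - 1) k) (ubar S j k) (ubar S (j + 1) k)"

definition slope_y :: "('m::finite) cu_data \<Rightarrow> int \<Rightarrow> int \<Rightarrow> real ^ 'm" where
  "slope_y S j k =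
     limited_slope (theta S) (dy S) (ubar S j (k - 1)) (ubar S j k) (ubar S j (k + 1))"

definition ux_minus :: "('m::finite) cu_data \<Rightarrow> int \<Rightarrow> int \<Rightarrow> real ^ 'm" where
  "ux_minus S j k = ubar S j k + (dx S / 2) *\<^sub>R slope_x S j k"

definition ux_plus :: "('m::finite) cu_data \<Rightarrow> int \<Rightarrow> int \<Rightarrow> real ^ 'm" where
  "ux_plus S j k = ubar S (j + 1) k - (dx S / 2) *\<^sub>R slope_x S (j + 1) k"

definition uy_minus :: "('m::finite) cu_data \<Rightarrow> int \<Rightarrow> int \<Rightarrow> real ^ 'm" where
  "uy_minus S j k = ubar S j k + (dy S / 2) *\<^sub>R slope_y S j k"

definition uy_plus :: "('m::finite) cu_data \<Rightarrow> int \<Rightarrow> int \<Rightarrow> real ^ 'm" where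
  "uy_plus S j k = ubar S j (k + 1) - (dy S / 2) *\<^sub>R slope_y S j (k + 1)"

definition sx_plus :: "('m::finite) cu_data \<Rightarrow> int \<Rightarrow> int \<Rightarrow> real" where
  "sx_plus S j k = speed_plus (eps S) (fl_f S) (ux_plus S j k) (ux_minus S j k)"

definition sx_minus :: "('m::finite) cu_data \<Rightarrow> int \<Rightarrow> int \<Rightarrow> real" where
  "sx_minus S j k = speed_minus (eps S) (fl_f S) (ux_plus S j k) (ux_minus S j k)"

definition sy_plus :: "('m::finite) cu_data \<Rightarrow> int \<Rightarrow> int \<Rightarrow> real" where
  "sy_plus S j k = speed_plus (eps S) (fl_g S) (uy_plus S j k) (uy_minus S j k)"

definition sy_minus :: "('m::finite) cu_data \<Rightarrow> int \<Rightarrow> int \<Rightarrow> real" where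
  "sy_minus S j k = speed_minus (eps S) (fl_g S) (uy_plus S j k) (uy_minus S j k)"

definition ustar_x :: "('m::finite) cu_data \<Rightarrow> int \<Rightarrow> int \<Rightarrow> real ^ 'm" where
  "ustar_x S j k =
     riemann_avg (fl_f S) (sx_plus S j k) (sx_minus S j k) (ux_plus S j k) (ux_minus S j k)"

definition ustar_y :: "('m::finite) cu_data \<Rightarrow> int \<Rightarrow> int \<Rightarrow> real ^ 'm" where
  "ustar_y S j k =
     riemann_avg (fl_g S) (sy_plus S j k) (sy_minus S j k) (uy_plus S j k) (uy_minus S j k)"

definition d_x :: "('m::finite) cu_data \<Rightarrow> int \<Rightarrow> int \<Rightarrow> real ^ 'm" where
  "d_x S j k = anti_diffusion (ustar_x S j k) (ux_plus S j k) (ux_minus S j k)"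

definition d_y :: "('m::finite) cu_data \<Rightarrow> int \<Rightarrow> int \<Rightarrow> real ^ 'm" where
  "d_y S j k = anti_diffusion (ustar_y S j k) (uy_plus S j k) (uy_minus S j k)"

definition fhat :: "('m::finite) cu_data \<Rightarrow> int \<Rightarrow> int \<Rightarrow> real ^ 'm" where
  "fhat S j k =
     cu_flux (fl_f S) (sx_plus S j k) (sx_minus S j k) (ux_plus S j k) (ux_minus S j k) (d_x S j k)"

definition ghat :: "('m::finite) cu_data \<Rightarrow> int \<Rightarrow> int \<Rightarrow> real ^ 'm" where
  "ghat S j k =
     cu_flux (fl_g S) (sy_plus S j k) (sy_minus S j k) (uy_plus S j k) (uy_minus S j k) (d_y S j k)"

definition ubar_next :: "('m::finite) cu_data \<Rightarrow> int \<Rightarrow> int \<Rightarrow> real ^ 'm" where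
  "ubar_next S j k =
     ubar S j k - lam S *\<^sub>R (fhat S j k - fhat S (j - 1) k)
                - mu S *\<^sub>R (ghat S j k - ghat S j (k - 1))"

definition ustar_plus_x :: "('m::finite) cu_data \<Rightarrow> int \<Rightarrow> int \<Rightarrow> real ^ 'm" where
  "ustar_plus_x S j k =
     ustar_x S j k - (sx_plus S j k / (sx_plus S j k - sx_minus S j k)) *\<^sub>R d_x S j k"

definition ustar_minus_x :: "('m::finite) cu_data \<Rightarrow> int \<Rightarrow> int \<Rightarrow> real ^ 'm" where
  "ustar_minus_x S j k =
     ustar_x S j k - (sx_minus S j k / (sx_plus S j k - sx_minus S j k)) *\<^sub>R d_x S j k"

definition ustar_plus_y :: "('m::finite) cu_data \<Rightarrow> int \<Rightarrow> int \<Rightarrow> real ^ 'm" where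
  "ustar_plus_y S j k =
     ustar_y S j k - (sy_plus S j k / (sy_plus S j k - sy_minus S j k)) *\<^sub>R d_y S j k"

definition ustar_minus_y :: "('m::finite) cu_data \<Rightarrow> int \<Rightarrow> int \<Rightarrow> real ^ 'm" where
  "ustar_minus_y S j k =
     ustar_y S j k - (sy_minus S j k / (sy_plus S j k - sy_minus S j k)) *\<^sub>R d_y S j k"

definition ustar_cell_x :: "('m::finite) cu_data \<Rightarrow> int \<Rightarrow> int \<Rightarrow> real ^ 'm" where
  "ustar_cell_x S j k =
     riemann_avg (fl_f S) (sx_plus S j k) (sx_minus S (j - 1) k) (ux_minus S j k) (ux_plus S (j - 1) k)"

definition ustar_cell_y :: "('m::finite) cu_data \<Rightarrow> int \<Rightarrow> int \<Rightarrow> real ^ 'm" where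
  "ustar_cell_y S j k =
     riemann_avg (fl_g S) (sy_plus S j k) (sy_minus S j (k - 1)) (uy_minus S j k) (uy_plus S j (k - 1))"

text \<open>The maxima range over the infinite grid, so they are rendered as suprema; they coincide with
  the maxima whenever these exist.  Their finiteness (\<open>bdd_above\<close>) is a
  hypothesis of the theorem.\<close>

definition gap_x :: "('m::finite) cu_data \<Rightarrow> int \<times> int \<Rightarrow> real" where
  "gap_x S = (\<lambda>(j, k). sx_plus S j k - sx_minus S j k)"

definition gap_y :: "('m::finite) cu_data \<Rightarrow> int \<times> int \<Rightarrow> real" where
  "gap_y S = (\<lambda>(j, k). sy_plus S j k - sy_minus S j k)"

definition alpha1 :: "('m::finite) cu_data \<Rightarrow> real" where
  "alpha1 S = (SUP jk. gap_x S jk)"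

definition alpha2 :: "('m::finite) cu_data \<Rightarrow> real" where
  "alpha2 S = (SUP jk. gap_y S jk)"

definition cu_setting :: "('m::finite) cu_data \<Rightarrow> bool" where
  "cu_setting S \<longleftrightarrow>
     hyperbolic_on (dom S) (fl_f S) (fl_g S) \<and>
     dx S > 0 \<and> dy S > 0 \<and> dt S > 0 \<and> eps S > 0 \<and> theta S \<in> {1..2} \<and>
     (\<forall>j k. {ux_minus S j k, ux_plus S j k, uy_minus S j k, uy_plus S j k} \<subseteq> dom S) \<and>
     (\<forall>j k. sx_plus S j k > sx_minus S (j - 1) k) \<and>
     (\<forall>j k. sy_plus S j k > sy_minus S j (k - 1))"

end

(* The Riemann average turns each interface flux into an upwind form based at either trace,
   F = h(u-) + s-(u^{*,+} - u-) = h(u+) + s+(u^{*,-} - u+).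
   In a flux difference the right interface is expanded at u- and the left one at u+, so the two
   remaining fluxes belong to the same cell and are absorbed by the Riemann average over that cell.
   The cell average is the midpoint of the two traces in each direction; splitting it between the
   directions in the ratio lam alpha1 : mu alpha2 is what makes all weights nonnegative. *)

theory Submission
  imports Defs
begin

lemma raw_speed_signs:
  "raw_speed_minus h up um \<le> 0" "0 \<le> raw_speed_plus h up um"
  by (simp_all add: raw_speed_minus_def raw_speed_plus_def)

lemma speed_signs:
  assumes "0 < \<epsilon>"
  shows "speed_minus \<epsilon> h up um \<le> 0" "0 \<le> speed_plus \<epsilon> h up um"
  using assms raw_speed_signs[of h up um] by (simp_all add: speed_minus_def speed_plus_def)

text \<open>Where the speeds are replaced the gap is \<open>2 * \<epsilon>\<close>; elsewhere the
  failed test is the bound itself. This keeps the interface denominators nonzero.\<close>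

lemma speed_gap_ge:
  assumes "0 < \<epsilon>"
  shows "\<epsilon> \<le> speed_plus \<epsilon> h up um - speed_minus \<epsilon> h up um"
  using assms by (simp add: speed_minus_def speed_plus_def)

lemma scaleR_riemann_avg:
  assumes "sp \<noteq> sm"
  shows "(sp - sm) *\<^sub>R riemann_avg h sp sm up um = sp *\<^sub>R up - sm *\<^sub>R um - h up + h um"
  using assms by (simp add: riemann_avg_def)

text \<open>Purely algebraic in all arguments: the Riemann average contributes
  \<open>sm / (sp - sm)\<close> to the coefficient of \<open>h um\<close>, and
  \<open>1 + sm / (sp - sm) = sp / (sp - sm)\<close> is its weight in the flux.\<close>

lemma cu_flux_upwind_minus:
  assumes "sp \<noteq> sm"
  shows "cu_flux h sp sm up um d =
    h um + sm *\<^sub>R (riemann_avg h sp sm up um - (sp / (sp - sm)) *\<^sub>R d - um)"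
proof -
  have "sp - sm \<noteq> 0"
    using assms by simp
  then show ?thesis
    unfolding cu_flux_def riemann_avg_def vec_eq_iff
    by (simp add: divide_simps) (simp add: algebra_simps)
qed

lemma cu_flux_upwind_plus:
  assumes "sp \<noteq> sm"
  shows "cu_flux h sp sm up um d =
    h up + sp *\<^sub>R (riemann_avg h sp sm up um - (sm / (sp - sm)) *\<^sub>R d - up)"
proof -
  have "sp - sm \<noteq> 0"
    using assms by simp
  then show ?thesis
    unfolding cu_flux_def riemann_avg_def vec_eq_iff
    by (simp add: divide_simps) (simp add: algebra_simps)
qed

text \<open>The leftover \<open>h upL - h umR\<close> equals \<open>(spR - smL)\<close> times the
  cell average, minus \<open>spR *\<^sub>R umR\<close>, plus \<open>smL *\<^sub>R upL\<close>; the
  last two complete the gap coefficients of the traces. Seen from the cell, \<open>umR\<close> is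
  its right state and \<open>upL\<close> its left one.\<close>

lemma cu_flux_difference:
  assumes "spR \<noteq> smR" "spL \<noteq> smL" "spR \<noteq> smL"
  shows "cu_flux h spL smL upL umL dL - cu_flux h spR smR upR umR dR =
    spL *\<^sub>R (riemann_avg h spL smL upL umL - (smL / (spL - smL)) *\<^sub>R dL)
    - smR *\<^sub>R (riemann_avg h spR smR upR umR - (spR / (spR - smR)) *\<^sub>R dR)
    + (spR - smL) *\<^sub>R riemann_avg h spR smL umR upL
    - (spL - smL) *\<^sub>R upL - (spR - smR) *\<^sub>R umR"
  unfolding cu_flux_upwind_plus[OF assms(2)] cu_flux_upwind_minus[OF assms(1)]
    scaleR_riemann_avg[OF assms(3)]
  by (simp add: algebra_simps)

lemma gap_ge_eps:
  assumes "0 < eps S"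
  shows "eps S \<le> gap_x S jk" "eps S \<le> gap_y S jk"
  using speed_gap_ge[OF assms]
  by (simp_all add: gap_x_def gap_y_def sx_plus_def sx_minus_def sy_plus_def sy_minus_def split_beta)

lemma gap_le_alpha:
  shows "bdd_above (range (gap_x S)) \<Longrightarrow> sx_plus S j k - sx_minus S j k \<le> alpha1 S"
    and "bdd_above (range (gap_y S)) \<Longrightarrow> sy_plus S j k - sy_minus S j k \<le> alpha2 S"
  using cSUP_upper[of "(j, k)" UNIV "gap_x S"] cSUP_upper[of "(j, k)" UNIV "gap_y S"]
  by (simp_all add: alpha1_def alpha2_def gap_x_def gap_y_def)

lemma fhat_difference:
  assumes "cu_setting S"
  shows "fhat S (j - 1) k - fhat S j k =
    sx_plus S (j - 1) k *\<^sub>R ustar_minus_x S (j - 1) k - sx_minus S j k *\<^sub>R ustar_plus_x S j k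
    + (sx_plus S j k - sx_minus S (j - 1) k) *\<^sub>R ustar_cell_x S j k
    - (sx_plus S (j - 1) k - sx_minus S (j - 1) k) *\<^sub>R ux_plus S (j - 1) k
    - (sx_plus S j k - sx_minus S j k) *\<^sub>R ux_minus S j k"
proof -
  have eps: "0 < eps S" and cell: "sx_minus S (j - 1) k < sx_plus S j k"
    using assms by (auto simp: cu_setting_def)
  have "sx_minus S i k < sx_plus S i k" for i
    using gap_ge_eps(1)[OF eps, of "(i, k)"] eps by (simp add: gap_x_def)
  then show ?thesis
    unfolding fhat_def ustar_minus_x_def ustar_plus_x_def ustar_cell_x_def ustar_x_def
    \<comment> \<open>The interface gaps separate the two speeds at each interface;
      \<open>cell\<close> separates speeds from opposite sides of the cell.\<close>
    using cell by (intro cu_flux_difference) (metis less_irrefl)+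
qed

lemma ghat_difference:
  assumes "cu_setting S"
  shows "ghat S j (k - 1) - ghat S j k =
    sy_plus S j (k - 1) *\<^sub>R ustar_minus_y S j (k - 1) - sy_minus S j k *\<^sub>R ustar_plus_y S j k
    + (sy_plus S j k - sy_minus S j (k - 1)) *\<^sub>R ustar_cell_y S j k
    - (sy_plus S j (k - 1) - sy_minus S j (k - 1)) *\<^sub>R uy_plus S j (k - 1)
    - (sy_plus S j k - sy_minus S j k) *\<^sub>R uy_minus S j k"
proof -
  have eps: "0 < eps S" and cell: "sy_minus S j (k - 1) < sy_plus S j k"
    using assms by (auto simp: cu_setting_def)
  have "sy_minus S j i < sy_plus S j i" for i
    using gap_ge_eps(2)[OF eps, of "(j, i)"] eps by (simp add: gap_y_def)
  then show ?thesis
    unfolding ghat_def ustar_minus_y_def ustar_plus_y_def ustar_cell_y_def ustar_y_def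
    using cell by (intro cu_flux_difference) (metis less_irrefl)+
qed

text \<open>Both traces inside a cell use the same slope, with opposite signs, so it cancels
  whatever the limiter returns.\<close>

lemma traces_sum:
  "ux_plus S (j - 1) k + ux_minus S j k = 2 *\<^sub>R ubar S j k"
  "uy_plus S j (k - 1) + uy_minus S j k = 2 *\<^sub>R ubar S j k"
  by (simp_all add: ux_plus_def ux_minus_def uy_plus_def uy_minus_def scaleR_2)

text \<open>The CFL bound enters here: dividing \<open>a\<close> by
  \<open>2 * (a + b) \<le> 1\<close> cannot decrease it.\<close>

lemma cfl_weight_ge:
  fixes a b :: real
  assumes "0 \<le> a" "0 < a + b" "a + b \<le> 1 / 2"
  shows "a \<le> a / (2 * (a + b))"
proof -
  have "a * (2 * (a + b)) \<le> a * 1"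
    using assms by (intro mult_left_mono) simp_all
  then show ?thesis
    using assms(2) by (simp add: pos_le_divide_eq)
qed

theorem theorem3p1:
  fixes S :: "('m::finite) cu_data" and j k :: int
  assumes "cu_setting S"
    and "bdd_above (range (gap_x S))"
    and "bdd_above (range (gap_y S))"
  shows
    "let w1 = lam S * alpha1 S / (2 * (lam S * alpha1 S + mu S * alpha2 S));
         w2 = mu S * alpha2 S / (2 * (lam S * alpha1 S + mu S * alpha2 S));
         terms =
           [(w1 - lam S * (sx_plus S (j - 1) k - sx_minus S (j - 1) k), ux_plus S (j - 1) k),
            (lam S * sx_plus S (j - 1) k,                               ustar_minus_x S (j - 1) k),
            (w1 - lam S * (sx_plus S j k - sx_minus S j k),             ux_minus S j k),
            (- lam S * sx_minus S j k,                                  ustar_plus_x S j k),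
            (lam S * (sx_plus S j k - sx_minus S (j - 1) k),            ustar_cell_x S j k),
            (w2 - mu S * (sy_plus S j (k - 1) - sy_minus S j (k - 1)),  uy_plus S j (k - 1)),
            (mu S * sy_plus S j (k - 1),                                ustar_minus_y S j (k - 1)),
            (w2 - mu S * (sy_plus S j k - sy_minus S j k),              uy_minus S j k),
            (- mu S * sy_minus S j k,                                   ustar_plus_y S j k),
            (mu S * (sy_plus S j k - sy_minus S j (k - 1)),             ustar_cell_y S j k)]
     in ubar_next S j k = (\<Sum>(c, u)\<leftarrow>terms. c *\<^sub>R u) \<and>
        (lam S * alpha1 S + mu S * alpha2 S \<le> 1 / 2 \<longrightarrow>
           (\<forall>(c, u)\<in>set terms. 0 \<le> c) \<and> (\<Sum>(c, u)\<leftarrow>terms. c) = 1)"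
proof -
  define a where "a = lam S * alpha1 S"
  define b where "b = mu S * alpha2 S"
  define w1 where "w1 = a / (2 * (a + b))"
  define w2 where "w2 = b / (2 * (a + b))"
  \<comment> \<open>Reversed, so that unfolding them folds the abbreviations into the goal.\<close>
  note abw = a_def[symmetric] b_def[symmetric] w1_def[symmetric] w2_def[symmetric]
  have eps: "0 < eps S" and lam: "0 < lam S" and mu: "0 < mu S"
    and cell: "sx_minus S (j - 1) k < sx_plus S j k" "sy_minus S j (k - 1) < sy_plus S j k"
    using assms(1) by (auto simp: cu_setting_def lam_def mu_def)
  have gap_x: "lam S * (sx_plus S i l - sx_minus S i l) \<le> a" for i l
    using gap_le_alpha(1)[OF assms(2)] lam by (simp add: a_def)
  have gap_y: "mu S * (sy_plus S i l - sy_minus S i l) \<le> b" for i l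
    using gap_le_alpha(2)[OF assms(3)] mu by (simp add: b_def)
  \<comment> \<open>A single interface in each direction suffices to make the suprema positive,
    hence \<open>a + b\<close> a legitimate denominator.\<close>
  have "eps S \<le> alpha1 S" "eps S \<le> alpha2 S"
    using gap_ge_eps[OF eps, of "(j, k)"] gap_le_alpha(1)[OF assms(2), of j k]
      gap_le_alpha(2)[OF assms(3), of j k]
    by (simp_all add: gap_x_def gap_y_def)
  then have pos: "0 < a" "0 < b"
    using eps lam mu by (simp_all add: a_def b_def)
  have half: "w1 + w2 = 1 / 2"
    using pos by (simp add: w1_def w2_def add_divide_distrib[symmetric])
  have signs: "sx_minus S i l \<le> 0" "0 \<le> sx_plus S i l" "sy_minus S i l \<le> 0" "0 \<le> sy_plus S i l"
    for i l
    using speed_signs[OF eps]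
    by (simp_all add: sx_minus_def sx_plus_def sy_minus_def sy_plus_def)
  have "ubar S j k = (2 * (w1 + w2)) *\<^sub>R ubar S j k"
    by (simp add: half)
  also have "\<dots> = w1 *\<^sub>R (2 *\<^sub>R ubar S j k) + w2 *\<^sub>R (2 *\<^sub>R ubar S j k)"
    by (simp add: algebra_simps)
  also have "\<dots> = w1 *\<^sub>R (ux_plus S (j - 1) k + ux_minus S j k)
      + w2 *\<^sub>R (uy_plus S j (k - 1) + uy_minus S j k)"
    by (simp only: traces_sum)
  finally have ubar: "ubar S j k = \<dots>" .
  have "ubar_next S j k = ubar S j k + lam S *\<^sub>R (fhat S (j - 1) k - fhat S j k)
      + mu S *\<^sub>R (ghat S j (k - 1) - ghat S j k)"
    by (simp add: ubar_next_def algebra_simps)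
  note decomposition = this[unfolded ubar fhat_difference[OF assms(1)] ghat_difference[OF assms(1)]]
  have weights: "a \<le> w1" "b \<le> w2" if "a + b \<le> 1 / 2"
    using cfl_weight_ge[of a b] cfl_weight_ge[of b a] that pos
    by (simp_all add: w1_def w2_def add.commute)
  have x_weight: "0 \<le> w1 - lam S * (sx_plus S i l - sx_minus S i l)" if "a + b \<le> 1 / 2" for i l
    using gap_x[of i l] weights(1)[OF that] by linarith
  have y_weight: "0 \<le> w2 - mu S * (sy_plus S i l - sy_minus S i l)" if "a + b \<le> 1 / 2" for i l
    using gap_y[of i l] weights(2)[OF that] by linarith
  \<comment> \<open>The weights of the intermediate states are nonnegative by the signs of the
    speeds and the assumed ordering across the cell.\<close>
  have interior: "0 \<le> lam S * sx_plus S (j - 1) k" "0 \<le> - lam S * sx_minus S j k"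
    "0 \<le> lam S * (sx_plus S j k - sx_minus S (j - 1) k)"
    "0 \<le> mu S * sy_plus S j (k - 1)" "0 \<le> - mu S * sy_minus S j k"
    "0 \<le> mu S * (sy_plus S j k - sy_minus S j (k - 1))"
    using signs cell lam mu by (simp_all add: mult_nonneg_nonpos less_imp_le)
  show ?thesis
    unfolding Let_def abw
  proof (intro conjI impI, goal_cases)
    case 1
    show ?case
      unfolding decomposition by (simp add: algebra_simps)
  next
    case 2
    then show ?case
      using x_weight y_weight interior by simp
  next
    \<comment> \<open>In each direction the speeds cancel, leaving
      \<open>2 * w1 + 2 * w2\<close>.\<close>
    case 3
    show ?case
      using half by (simp add: algebra_simps)
  qed
qed

end
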